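(* For every $k=1,2,\dots$ and every $n=1,2,\dots$, $$(-1)^{T^k(n)}=\overline{b_1}\,\omega_{1,k}^n+\overline{b_2}\,\omega_{2,k}^n+\cdots+\overline{b_{2^k}}\,\omega_{2^k,k}^n,$$ where $b_j=\frac{P_k(\omega_{j,k})}{2^k}$ for $j=1,\dots,2^k$, and these coefficients satisfy $$\sum_{j=1}^{2^k}b_j=\sum_{j=1}^{2^k}\frac{P_k(\omega_{j,k})}{2^k}=1.$$
   Context: The Collatz map $T$ on positive integers is $T(n)=n/2$ for $n$ even and $T(n)=(3n+1)/2$ for $n$ odd. For $j=1,\dots,2^k$, $\omega_{j,k}=\exp\left(\frac{(2j-1)\pi i}{2^k}\right)$ are the $2^k$-th roots of $-1$ in $\mathbb{C}$. $P_k$ is the polynomial $P_k(x)=\sum_{\upsilon=1}^{2^k}(-1)^{T^k(\upsilon)}x^\upsilon$. The bar denotes complex conjugation. *)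

theory Defs
  imports Complex_Main "HOL-Computational_Algebra.Polynomial"
begin

text \<open>The Collatz map lives on the positive integers; the value at \<open>0\<close> is irrelevant, since
  positive integers are mapped to positive integers.\<close>

definition T :: "nat \<Rightarrow> nat" where
  "T n = (if even n then n div 2 else (3 * n + 1) div 2)"

text \<open>The \<open>2 ^ k\<close>-th roots of \<open>-1\<close> for \<open>1 \<le> j \<le> 2 ^ k\<close>; truncated subtraction is harmless
  there.\<close>

definition \<omega> :: "nat \<Rightarrow> nat \<Rightarrow> complex" where
  "\<omega> j k = exp (of_nat (2 * j - 1) * of_real pi * \<i> / 2 ^ k)"

definition P :: "nat \<Rightarrow> complex poly" where
  "P k = (\<Sum>v = 1..2 ^ k. monom ((-1) ^ ((T ^^ k) v)) v)"

definition b :: "nat \<Rightarrow> nat \<Rightarrow> complex" where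
  "b k j = poly (P k) (\<omega> j k) / 2 ^ k"

end

theory Submission imports Defs
begin

text \<open>
  Put \<open>N = 2 ^ k\<close> and \<open>f n = (-1) ^ (T ^^ k) n\<close>. The parities of the first \<open>k\<close> iterates of \<open>n\<close>
  depend only on \<open>n\<close> modulo \<open>N\<close>, so on a residue class modulo \<open>N\<close> the map \<open>T ^^ k\<close> is affine: adding
  \<open>N\<close> to \<open>n\<close> adds an odd number (a power of \<open>3\<close>) to \<open>(T ^^ k) n\<close>. Hence \<open>f\<close> is antiperiodic:
  \<open>f (n + N) = - f n\<close> (lemma \<open>sign_antiperiodic\<close>). The sequences \<open>\<omega>\<^sub>j ^ n\<close> with \<open>\<omega>\<^sub>j ^ N = -1\<close> have
  the same antiperiod, and they are orthogonal on the window \<open>1, \<dots>, N\<close> (lemma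
  \<open>orthogonality_roots_minus_one\<close>). The theorem is therefore Fourier inversion: \<open>cnj (b k j)\<close> is the
  Fourier coefficient of the real sequence \<open>f\<close>, inversion holds on the window, and antiperiodicity
  carries it to all \<open>n\<close>.

  For the sum of the coefficients, summing \<open>\<omega>\<^sub>j ^ v\<close> over \<open>j\<close> kills every term of \<open>P k\<close> except the one
  with \<open>v = N\<close>, where each \<open>\<omega>\<^sub>j ^ N\<close> is \<open>-1\<close>. The result is \<open>- f N\<close>, which is \<open>1\<close> because \<open>k\<close>
  halvings take \<open>2 ^ k\<close> to \<open>1\<close>.
\<close>

section \<open>Antiperiodicity of the parity of Collatz iterates\<close>

text \<open>A step preserves the shape of the shift: \<open>2 ^ Suc k * m\<close> becomes \<open>2 ^ k * m\<close> after a halving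
  and \<open>2 ^ k * (3 * m)\<close> after an odd step, so the exponent \<open>s\<close> counts the odd steps. The factor \<open>m\<close>
  is what lets the induction absorb these powers of \<open>3\<close>.\<close>

lemma Collatz_iterate_shift:
  "\<exists>s. \<forall>m. (T ^^ k) (n + 2 ^ k * m) = (T ^^ k) n + 3 ^ s * m"
proof (induction k arbitrary: n)
  case 0
  show ?case by (auto intro: exI[of _ 0])
next
  case (Suc k)
  obtain s where s: "\<And>m. (T ^^ k) (T n + 2 ^ k * m) = (T ^^ k) (T n) + 3 ^ s * m"
    using Suc by blast
  show ?case
  proof (cases "even n")
    case True
    then have "T (n + 2 ^ Suc k * m) = T n + 2 ^ k * m" for m
      by (auto simp: T_def elim!: evenE)
    then show ?thesis
      by (auto simp: funpow_Suc_right s simp del: funpow.simps intro!: exI[of _ s])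
  next
    case False
    have "T (n + 2 ^ Suc k * m) = T n + 2 ^ k * (3 * m)" for m
    proof -
      have "3 * (n + 2 ^ Suc k * m) + 1 = (3 * n + 1) + 2 * (2 ^ k * (3 * m))" by simp
      then show ?thesis using False by (simp add: T_def)
    qed
    then show ?thesis
      by (auto simp: funpow_Suc_right s simp del: funpow.simps intro!: exI[of _ "Suc s"])
  qed
qed

lemma sign_antiperiodic:
  "(-1 :: complex) ^ (T ^^ k) (n + 2 ^ k) = - ((-1) ^ (T ^^ k) n)"
proof -
  obtain s where "(T ^^ k) (n + 2 ^ k * 1) = (T ^^ k) n + 3 ^ s * 1"
    using Collatz_iterate_shift by blast
  then show ?thesis by (simp add: power_add)
qed

lemma Collatz_iterate_power_2: "(T ^^ k) (2 ^ k) = 1"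
  by (induction k) (simp_all add: funpow_Suc_right T_def del: funpow.simps)

section \<open>Orthogonality of the roots of minus one\<close>

lemma omega_eq_cis: "\<omega> j k = cis (real (2 * j - 1) * pi / 2 ^ k)"
  by (simp add: \<omega>_def cis_conv_exp mult_ac)

lemma omega_power_period:
  assumes "j \<ge> 1"
  shows "\<omega> j k ^ (2 ^ k) = -1"
proof -
  have "\<omega> j k ^ (2 ^ k) = cis (pi * real (2 * j - 1))"
    by (simp add: omega_eq_cis DeMoivre mult_ac)
  also have "\<dots> = cis pi ^ (2 * j - 1)"
    by (simp only: DeMoivre mult.commute)
  finally show ?thesis using assms by (simp add: uminus_power_if)
qed

lemma omega_mult_cnj: "\<omega> j k * cnj (\<omega> j k) = 1"
  by (simp add: omega_eq_cis cis_cnj cis_mult)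

text \<open>The roots form a geometric progression with ratio \<open>\<zeta> = cis (2 * pi / 2 ^ k)\<close>, so this is a
  geometric sum with ratio \<open>\<zeta> ^ d\<close>; that ratio is a \<open>2 ^ k\<close>-th root of unity, and it differs from
  \<open>1\<close> exactly when \<open>d\<close> is not a multiple of \<open>2 ^ k\<close>.\<close>

lemma sum_omega_power:
  assumes "d < 2 ^ k"
  shows "(\<Sum>j = 1..2 ^ k. \<omega> j k ^ d) = (if d = 0 then 2 ^ k else 0)"
proof (cases "d = 0")
  case False
  define q where "q = cis (2 * pi * real d / real (2 ^ k))"
  have "inj_on (\<lambda>i. cis (2 * pi * real i / real (2 ^ k))) {..<2 ^ k}"
    using bij_betw_roots_unity[of "2 ^ k"] by (simp add: bij_betw_def)
  from inj_onD[OF this, of d 0] have "q \<noteq> 1"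
    using assms False by (auto simp: q_def)
  have "q ^ (2 ^ k) = cis (2 * pi) ^ d"
    by (simp add: q_def DeMoivre mult_ac)
  then have "q ^ (2 ^ k) = 1" by simp
  have "(\<Sum>j = 1..2 ^ k. \<omega> j k ^ d) = (\<Sum>i<2 ^ k. \<omega> (Suc i) k ^ d)"
    by (rule sum.reindex_bij_witness[of _ Suc "\<lambda>j. j - 1"]) auto
  also have "\<dots> = (\<Sum>i<2 ^ k. cis (pi * real d / 2 ^ k) * q ^ i)"
    by (intro sum.cong) (simp_all add: omega_eq_cis q_def DeMoivre cis_mult field_simps)
  also have "\<dots> = 0"
    using \<open>q \<noteq> 1\<close> \<open>q ^ (2 ^ k) = 1\<close>
    by (simp add: sum_distrib_left[symmetric] geometric_sum)
  finally show ?thesis using False by simp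
qed simp

lemma orthogonality_roots_minus_one:
  assumes "n \<in> {1..2 ^ k}" and "v \<in> {1..2 ^ k}"
  shows "(\<Sum>j = 1..2 ^ k. cnj (\<omega> j k) ^ v * \<omega> j k ^ n) = (if v = n then 2 ^ k else 0)"
proof (cases "v \<le> n")
  case True
  have "cnj (\<omega> j k) ^ v * \<omega> j k ^ n = \<omega> j k ^ (n - v)" for j
  proof -
    have "cnj (\<omega> j k) ^ v * \<omega> j k ^ (v + (n - v)) = (\<omega> j k * cnj (\<omega> j k)) ^ v * \<omega> j k ^ (n - v)"
      by (simp only: power_add power_mult_distrib mult_ac)
    then show ?thesis using True by (simp add: omega_mult_cnj)
  qed
  then show ?thesis using True assms sum_omega_power[of "n - v" k] by auto
next
  case False
  have "cnj (\<omega> j k) ^ v * \<omega> j k ^ n = cnj (\<omega> j k ^ (v - n))" for j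
  proof -
    have "cnj (\<omega> j k) ^ (n + (v - n)) * \<omega> j k ^ n
        = (\<omega> j k * cnj (\<omega> j k)) ^ n * cnj (\<omega> j k) ^ (v - n)"
      by (simp only: power_add power_mult_distrib mult_ac)
    then show ?thesis using False by (simp add: omega_mult_cnj)
  qed
  then have "(\<Sum>j = 1..2 ^ k. cnj (\<omega> j k) ^ v * \<omega> j k ^ n) = cnj (\<Sum>j = 1..2 ^ k. \<omega> j k ^ (v - n))"
    by simp
  also have "\<dots> = 0"
    using False assms sum_omega_power[of "v - n" k] by auto
  finally show ?thesis using False by auto
qed

section \<open>Fourier inversion\<close>

lemma b_eq_sum:
  "b k j = (\<Sum>v = 1..2 ^ k. (-1) ^ (T ^^ k) v * \<omega> j k ^ v) / 2 ^ k"
  by (simp add: b_def P_def poly_sum poly_monom)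

lemma Fourier_inversion_window:
  assumes "n \<in> {1..2 ^ k}"
  shows "(\<Sum>j = 1..2 ^ k. cnj (b k j) * \<omega> j k ^ n) = (-1) ^ (T ^^ k) n"
proof -
  have "(\<Sum>j = 1..2 ^ k. cnj (b k j) * \<omega> j k ^ n)
      = (\<Sum>j = 1..2 ^ k. \<Sum>v = 1..2 ^ k.
           (-1) ^ (T ^^ k) v / 2 ^ k * (cnj (\<omega> j k) ^ v * \<omega> j k ^ n))"
    by (simp add: b_eq_sum sum_divide_distrib sum_distrib_left sum_distrib_right mult_ac)
  also have "\<dots> = (\<Sum>v = 1..2 ^ k. (-1) ^ (T ^^ k) v / 2 ^ k *
           (\<Sum>j = 1..2 ^ k. cnj (\<omega> j k) ^ v * \<omega> j k ^ n))"
    by (subst sum.swap) (simp add: sum_distrib_left)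
  also have "\<dots> = (\<Sum>v = 1..2 ^ k. if v = n then (-1) ^ (T ^^ k) v else 0)"
    by (intro sum.cong refl) (simp only: orthogonality_roots_minus_one[OF assms], simp)
  also have "\<dots> = (-1) ^ (T ^^ k) n"
    using assms by simp
  finally show ?thesis .
qed

lemma Fourier_inversion:
  assumes "n \<ge> 1"
  shows "(\<Sum>j = 1..2 ^ k. cnj (b k j) * \<omega> j k ^ n) = (-1) ^ (T ^^ k) n"
  using assms
proof (induction n rule: less_induct)
  case (less n)
  show ?case
  proof (cases "n \<le> 2 ^ k")
    case True
    then show ?thesis using less.prems by (intro Fourier_inversion_window) simp
  next
    case False
    define m where "m = n - 2 ^ k"
    have n: "n = m + 2 ^ k" and m: "m < n" "m \<ge> 1"
      using False by (auto simp: m_def)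
    have "(\<Sum>j = 1..2 ^ k. cnj (b k j) * \<omega> j k ^ n)
        = (\<Sum>j = 1..2 ^ k. - (cnj (b k j) * \<omega> j k ^ m))"
      by (intro sum.cong refl) (simp add: n power_add omega_power_period)
    also have "\<dots> = - ((-1) ^ (T ^^ k) m)"
      using less.IH[OF m] by (simp add: sum_negf)
    finally show ?thesis by (simp add: n sign_antiperiodic)
  qed
qed

lemma sum_b: "(\<Sum>j = 1..2 ^ k. b k j) = 1"
proof -
  have "(\<Sum>j = 1..2 ^ k. b k j)
      = (\<Sum>v = 1..2 ^ k. (-1) ^ (T ^^ k) v / 2 ^ k * (\<Sum>j = 1..2 ^ k. \<omega> j k ^ v))"
    unfolding b_eq_sum sum_divide_distrib
    by (subst sum.swap) (simp add: sum_distrib_left)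
  also have "\<dots> = (\<Sum>v = 1..2 ^ k. if v = (2 :: nat) ^ k then 1 else 0)"
  proof (intro sum.cong refl)
    fix v :: nat
    assume v: "v \<in> {1..2 ^ k}"
    show "(-1) ^ (T ^^ k) v / 2 ^ k * (\<Sum>j = 1..2 ^ k. \<omega> j k ^ v) = (if v = 2 ^ k then 1 else 0)"
    proof (cases "v = 2 ^ k")
      case True
      have "(\<Sum>j = 1..2 ^ k. \<omega> j k ^ (2 ^ k)) = (\<Sum>j = 1..(2 :: nat) ^ k. - 1)"
        by (intro sum.cong refl) (simp add: omega_power_period)
      then show ?thesis using True by (simp add: Collatz_iterate_power_2)
    next
      case False
      then show ?thesis using v sum_omega_power[of v k] by simp
    qed
  qed
  also have "\<dots> = 1" by simp
  finally show ?thesis .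
qed

theorem theorem7p5:
  fixes k :: nat
  assumes "k \<ge> 1"
  shows "(\<forall>n::nat. n \<ge> 1 \<longrightarrow>
            (-1 :: complex) ^ ((T ^^ k) n) = (\<Sum>j = 1..2 ^ k. cnj (b k j) * \<omega> j k ^ n))
         \<and> (\<Sum>j = 1..2 ^ k. b k j) = (\<Sum>j = 1..2 ^ k. poly (P k) (\<omega> j k) / 2 ^ k)
         \<and> (\<Sum>j = 1..2 ^ k. poly (P k) (\<omega> j k) / 2 ^ k) = 1"
  using Fourier_inversion[of _ k] sum_b[of k] by (simp add: b_def)

end
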